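(* Let $\mathbb{X}, \mathbb{Y}$ be real Banach spaces and let $\mathbb{Z} = \mathbb{X} \bigoplus_{\infty} \mathbb{Y}$. Then $(x,y) \in S_{\mathbb{Z}}$ is a right-symmetric point in $\mathbb{Z}$ if and only if $\|x\| = \|y\| = 1$ and $x, y$ are right-symmetric points in $\mathbb{X}$ and $\mathbb{Y}$ respectively.
   Context: $\mathbb{X} \bigoplus_{\infty} \mathbb{Y}$ denotes the infinity sum of $\mathbb{X}$ and $\mathbb{Y}$, that is, their direct sum endowed with the norm $\|(x,y)\| = \max\{\|x\|,\|y\|\}$; the same symbol $\|\cdot\|$ is used for the norms of $\mathbb{X}$, $\mathbb{Y}$ and $\mathbb{Z}$. For a real Banach space $\mathbb{Z}$, $S_{\mathbb{Z}} = \{z \in \mathbb{Z} : \|z\| = 1\}$ is its unit sphere. For $x,y$ in a real Banach space, $x$ is Birkhoff-James orthogonal to $y$, written $x \perp_B y$, if $\|x+\lambda y\| \geq \|x\|$ for all $\lambda \in \mathbb{R}$. An element $x$ of a real Banach space $\mathbb{X}$ is a right-symmetric point in $\mathbb{X}$ if for every $y \in \mathbb{X}$, $y \perp_B x$ implies $x \perp_B y$.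
   Formalization: The Banach spaces X and Y are both assumed to be nonzero; for X = {0} and Y = ℝ the point (0,1) is right-symmetric in the unit sphere of Z although its first coordinate has norm 0, so the claim fails there. *)

theory Defs
  imports "HOL-Analysis.Analysis"
begin

text \<open>The library norm on the product type is the Euclidean one, so the infinity sum is
  a separate type.\<close>

datatype ('a, 'b) inf_sum = InfSum (inf_fst: 'a) (inf_snd: 'b)

instantiation inf_sum :: (real_vector, real_vector) real_vector
begin

definition zero_inf_sum :: "('a, 'b) inf_sum" where
  "0 = InfSum 0 0"

definition plus_inf_sum :: "('a, 'b) inf_sum \<Rightarrow> ('a, 'b) inf_sum \<Rightarrow> ('a, 'b) inf_sum" where
  "z + w = InfSum (inf_fst z + inf_fst w) (inf_snd z + inf_snd w)"

definition minus_inf_sum :: "('a, 'b) inf_sum \<Rightarrow> ('a, 'b) inf_sum \<Rightarrow> ('a, 'b) inf_sum" where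
  "z - w = InfSum (inf_fst z - inf_fst w) (inf_snd z - inf_snd w)"

definition uminus_inf_sum :: "('a, 'b) inf_sum \<Rightarrow> ('a, 'b) inf_sum" where
  "- z = InfSum (- inf_fst z) (- inf_snd z)"

definition scaleR_inf_sum :: "real \<Rightarrow> ('a, 'b) inf_sum \<Rightarrow> ('a, 'b) inf_sum" where
  "r *\<^sub>R z = InfSum (r *\<^sub>R inf_fst z) (r *\<^sub>R inf_snd z)"

instance
  by standard
    (simp_all add: zero_inf_sum_def plus_inf_sum_def minus_inf_sum_def uminus_inf_sum_def
      scaleR_inf_sum_def scaleR_add_right scaleR_add_left)

end

instantiation inf_sum :: (real_normed_vector, real_normed_vector) real_normed_vector
begin

definition norm_inf_sum :: "('a, 'b) inf_sum \<Rightarrow> real" where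
  "norm_inf_sum z = max (norm (inf_fst z)) (norm (inf_snd z))"

definition dist_inf_sum :: "('a, 'b) inf_sum \<Rightarrow> ('a, 'b) inf_sum \<Rightarrow> real" where
  "dist_inf_sum z w = norm (z - w)"

definition sgn_inf_sum :: "('a, 'b) inf_sum \<Rightarrow> ('a, 'b) inf_sum" where
  "sgn_inf_sum z = z /\<^sub>R norm z"

definition uniformity_inf_sum :: "(('a, 'b) inf_sum \<times> ('a, 'b) inf_sum) filter" where
  "uniformity_inf_sum = (INF e\<in>{0<..}. principal {(z, w). dist z w < e})"

definition open_inf_sum :: "('a, 'b) inf_sum set \<Rightarrow> bool" where
  "open_inf_sum U \<longleftrightarrow> (\<forall>z\<in>U. \<forall>\<^sub>F (z', w) in uniformity. z' = z \<longrightarrow> w \<in> U)"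

instance
proof
  fix z w :: "('a, 'b) inf_sum" and r :: real and U :: "('a, 'b) inf_sum set"
  show "dist z w = norm (z - w)"
    by (rule dist_inf_sum_def)
  show "sgn z = z /\<^sub>R norm z"
    by (rule sgn_inf_sum_def)
  show "(uniformity :: (('a, 'b) inf_sum \<times> ('a, 'b) inf_sum) filter) =
      (INF e\<in>{0<..}. principal {(z, w). dist z w < e})"
    by (rule uniformity_inf_sum_def)
  show "open U \<longleftrightarrow> (\<forall>z\<in>U. \<forall>\<^sub>F (z', w) in uniformity. z' = z \<longrightarrow> w \<in> U)"
    by (rule open_inf_sum_def)
  show "norm z = 0 \<longleftrightarrow> z = 0"
    by (cases z) (auto simp: norm_inf_sum_def zero_inf_sum_def max_def)
  have "norm (inf_fst z + inf_fst w) \<le> norm (inf_fst z) + norm (inf_fst w)"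
    "norm (inf_snd z + inf_snd w) \<le> norm (inf_snd z) + norm (inf_snd w)"
    by (rule norm_triangle_ineq)+
  then show "norm (z + w) \<le> norm z + norm w"
    unfolding norm_inf_sum_def plus_inf_sum_def inf_sum.sel by linarith
  show "norm (r *\<^sub>R z) = \<bar>r\<bar> * norm z"
    by (simp add: norm_inf_sum_def scaleR_inf_sum_def max_mult_distrib_left)
qed

end

lemma norm_InfSum [simp]: "norm (InfSum x y) = max (norm x) (norm y)"
  by (simp add: norm_inf_sum_def)

instance inf_sum :: (banach, banach) banach
proof
  fix f :: "nat \<Rightarrow> ('a, 'b) inf_sum"
  assume f: "Cauchy f"
  have dist_eq: "dist z w = max (dist (inf_fst z) (inf_fst w)) (dist (inf_snd z) (inf_snd w))"
    for z w :: "('a, 'b) inf_sum"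
    by (simp add: dist_inf_sum_def minus_inf_sum_def dist_norm)
  have "Cauchy (\<lambda>n. inf_fst (f n))" "Cauchy (\<lambda>n. inf_snd (f n))"
    using f by (simp_all add: Cauchy_def dist_eq) meson+
  then obtain x y where x: "(\<lambda>n. inf_fst (f n)) \<longlonglongrightarrow> x" and y: "(\<lambda>n. inf_snd (f n)) \<longlonglongrightarrow> y"
    by (meson Cauchy_convergent convergent_def)
  have "f \<longlonglongrightarrow> InfSum x y"
  proof (rule tendstoI)
    fix e :: real
    assume "0 < e"
    then have "\<forall>\<^sub>F n in sequentially. dist (inf_fst (f n)) x < e"
      "\<forall>\<^sub>F n in sequentially. dist (inf_snd (f n)) y < e"
      using x y by (auto dest: tendstoD)
    then show "\<forall>\<^sub>F n in sequentially. dist (f n) (InfSum x y) < e"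
      by eventually_elim (simp add: dist_eq)
  qed
  then show "convergent f"
    by (auto simp: convergent_def)
qed

definition bj_orthogonal :: "'a::real_normed_vector \<Rightarrow> 'a \<Rightarrow> bool" (infix "\<bottom>\<^sub>B" 50) where
  "x \<bottom>\<^sub>B y \<longleftrightarrow> (\<forall>r::real. norm (x + r *\<^sub>R y) \<ge> norm x)"

definition right_symmetric :: "'a::real_normed_vector \<Rightarrow> bool" where
  "right_symmetric x \<longleftrightarrow> (\<forall>y. y \<bottom>\<^sub>B x \<longrightarrow> x \<bottom>\<^sub>B y)"

end

theory Submission
  imports Defs
begin

text \<open>Birkhoff-James orthogonality splits into two one-sided conditions, one for
  \<open>r \<ge> 0\<close> and one for \<open>r \<le> 0\<close>. By convexity of the norm each one-sided condition is local at
  \<open>r = 0\<close>, so in the infinity sum it holds exactly if it holds in one coordinate of maximal norm.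
  Moreover a right-symmetric point reverses already the one-sided relation: if \<open>v\<close> does not get
  shorter in direction \<open>y\<close>, subtract the multiple of \<open>y\<close> that makes \<open>v - s y\<close> shortest, which
  has \<open>s \<ge> 0\<close>, and apply right symmetry to \<open>v - s y\<close>.\<close>

section \<open>One-sided orthogonality in a single normed space\<close>

definition bj_orthogonal_pos :: "'a::real_normed_vector \<Rightarrow> 'a \<Rightarrow> bool" where
  "bj_orthogonal_pos x y \<longleftrightarrow> (\<forall>r\<ge>0. norm x \<le> norm (x + r *\<^sub>R y))"

lemma bj_orthogonal_iff_pos:
  "x \<bottom>\<^sub>B y \<longleftrightarrow> bj_orthogonal_pos x y \<and> bj_orthogonal_pos x (- y)"
proof
  assume "x \<bottom>\<^sub>B y"
  then have "norm x \<le> norm (x + r *\<^sub>R y)" for r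
    by (simp add: bj_orthogonal_def)
  from this this[of "- r" for r] show "bj_orthogonal_pos x y \<and> bj_orthogonal_pos x (- y)"
    by (simp add: bj_orthogonal_pos_def)
next
  assume *: "bj_orthogonal_pos x y \<and> bj_orthogonal_pos x (- y)"
  have "norm x \<le> norm (x + r *\<^sub>R y)" for r
  proof (cases "r \<ge> 0")
    case True
    then show ?thesis using * by (simp add: bj_orthogonal_pos_def)
  next
    case False
    then have "norm x \<le> norm (x + (- r) *\<^sub>R (- y))"
      using * unfolding bj_orthogonal_pos_def by (meson less_imp_le neg_0_le_iff_le not_le)
    then show ?thesis by simp
  qed
  then show "x \<bottom>\<^sub>B y"
    by (simp add: bj_orthogonal_def)
qed

lemma bj_orthogonal_pos_uminus_iff:
  "bj_orthogonal_pos (- x) y \<longleftrightarrow> bj_orthogonal_pos x (- y)"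
proof -
  have "norm (- x + r *\<^sub>R y) = norm (x + r *\<^sub>R (- y))" for r
    by (metis add.commute minus_add_distrib minus_minus norm_minus_cancel scaleR_minus_right)
  then show ?thesis
    by (simp add: bj_orthogonal_pos_def)
qed

lemma not_bj_orthogonal_pos_uminus_scaleR:
  assumes "x \<noteq> 0" "0 < c"
  shows "\<not> bj_orthogonal_pos x (- (c *\<^sub>R x))"
proof
  assume "bj_orthogonal_pos x (- (c *\<^sub>R x))"
  \<comment> \<open>The step length \<open>1 / c\<close> carries \<open>x\<close> exactly to
    \<open>0\<close>.\<close>
  then have "norm x \<le> norm (x + (1 / c) *\<^sub>R (- (c *\<^sub>R x)))"
    using assms unfolding bj_orthogonal_pos_def by (meson less_imp_le zero_less_divide_1_iff)
  with assms show False by simp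
qed

lemma exists_minimal_norm_diff_scaleR:
  assumes "bj_orthogonal_pos v y" "y \<noteq> 0"
  obtains s where "0 \<le> s" "(v - s *\<^sub>R y) \<bottom>\<^sub>B y"
proof -
  \<comment> \<open>For \<open>t > R\<close> the subtracted multiple of \<open>y\<close> has norm at
    least \<open>2 * norm v\<close>, so the difference is no shorter than \<open>v\<close>. For
    \<open>t < 0\<close> the hypothesis on \<open>v\<close> says the same, so the minimum over the
    compact interval is global.\<close>
  define R where "R = 2 * norm v / norm y"
  have R: "0 \<le> R" by (simp add: R_def)
  have "continuous_on {0..R} (\<lambda>s. norm (v - s *\<^sub>R y))"
    by (intro continuous_intros)
  then obtain s where s: "s \<in> {0..R}"
    and min: "\<And>t. t \<in> {0..R} \<Longrightarrow> norm (v - s *\<^sub>R y) \<le> norm (v - t *\<^sub>R y)"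
    using continuous_attains_inf[of "{0..R}" "\<lambda>s. norm (v - s *\<^sub>R y)"] R by auto
  have le_v: "norm (v - s *\<^sub>R y) \<le> norm v"
    using min[of 0] R by simp
  have all: "norm (v - s *\<^sub>R y) \<le> norm (v - t *\<^sub>R y)" for t
  proof -
    consider "t < 0" | "t \<in> {0..R}" | "R < t" by fastforce
    then show ?thesis
    proof cases
      case 1
      then have "norm v \<le> norm (v + (- t) *\<^sub>R y)"
        using assms(1) unfolding bj_orthogonal_pos_def by (meson less_imp_le neg_0_le_iff_le)
      then show ?thesis using le_v by simp
    next
      case 2
      then show ?thesis by (rule min)
    next
      case 3
      then have "2 * norm v \<le> t * norm y"
        using assms(2) by (simp add: R_def divide_less_eq)
      moreover have "norm (t *\<^sub>R y) - norm v \<le> norm (v - t *\<^sub>R y)"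
        by (metis norm_minus_commute norm_triangle_ineq2)
      ultimately show ?thesis using 3 R le_v by simp
    qed
  qed
  have "norm (v - s *\<^sub>R y) \<le> norm (v - s *\<^sub>R y + r *\<^sub>R y)" for r
    using all[of "s - r"] by (simp add: algebra_simps)
  then have "(v - s *\<^sub>R y) \<bottom>\<^sub>B y"
    by (simp add: bj_orthogonal_def)
  with s that[of s] show thesis by simp
qed

lemma right_symmetric_bj_orthogonal_pos:
  assumes y: "right_symmetric y" and v: "bj_orthogonal_pos v y"
  shows "bj_orthogonal_pos y v"
proof (cases "y = 0")
  case True
  then show ?thesis by (simp add: bj_orthogonal_pos_def)
next
  case False
  with v obtain s where s: "0 \<le> s" "(v - s *\<^sub>R y) \<bottom>\<^sub>B y"
    by (rule exists_minimal_norm_diff_scaleR)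
  with y have orth: "y \<bottom>\<^sub>B (v - s *\<^sub>R y)"
    by (simp add: right_symmetric_def)
  have "norm y \<le> norm (y + r *\<^sub>R v)" if r: "0 \<le> r" for r
  proof -
    \<comment> \<open>Collecting the multiples of \<open>y\<close> in
      \<open>y + r v = (1 + r s) y + r (v - s y)\<close> yields this factor. Here the sign of
      \<open>s\<close> matters: it gives \<open>c \<ge> 1\<close>, so pulling \<open>c\<close> out
      cannot lose norm.\<close>
    define c where "c = 1 + r * s"
    have c: "1 \<le> c" using r s by (simp add: c_def)
    have "y + r *\<^sub>R v = c *\<^sub>R (y + (r / c) *\<^sub>R (v - s *\<^sub>R y))"
      using c by (simp add: scaleR_add_right) (simp add: c_def algebra_simps)
    then have "norm (y + r *\<^sub>R v) = c * norm (y + (r / c) *\<^sub>R (v - s *\<^sub>R y))"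
      using c by simp
    also have "\<dots> \<ge> 1 * norm y"
      using orth c by (intro mult_mono) (auto simp: bj_orthogonal_def)
    finally show ?thesis by simp
  qed
  then show ?thesis by (simp add: bj_orthogonal_pos_def)
qed

text \<open>One point of the ray with norm below \<open>M\<close> suffices: every point strictly
  between it and \<open>u\<close> is a convex combination that gives it positive weight, while
  \<open>u\<close> itself has norm at most \<open>M\<close>.\<close>

lemma norm_add_scaleR_less_near_0:
  assumes "norm u \<le> M" and "\<not> (norm u = M \<and> bj_orthogonal_pos u x)"
  obtains e where "0 < e" "\<And>t. 0 < t \<Longrightarrow> t \<le> e \<Longrightarrow> norm (u + t *\<^sub>R x) < M"
proof -
  obtain e where e: "0 < e" "norm (u + e *\<^sub>R x) < M"
  proof (cases "norm u = M")
    case True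
    with assms obtain r where r: "0 \<le> r" "norm (u + r *\<^sub>R x) < M"
      by (auto simp: bj_orthogonal_pos_def not_le)
    with True have "r \<noteq> 0" by auto
    with r that[of r] show thesis by simp
  next
    case False
    \<comment> \<open>The gap \<open>M - norm u\<close> bounds how far one may move; the summand
      \<open>1\<close> keeps the denominator positive and makes the estimate strict, even for
      \<open>x = 0\<close>.\<close>
    define e where "e = (M - norm u) / (norm x + 1)"
    have pos: "0 < norm x + 1"
      by (smt (verit) norm_ge_zero)
    with False assms have e: "0 < e" by (simp add: e_def)
    have "norm (u + e *\<^sub>R x) \<le> norm u + e * norm x"
      using e norm_triangle_ineq[of u "e *\<^sub>R x"] by simp
    also have "\<dots> < norm u + e * (norm x + 1)"
      using e by (simp add: algebra_simps)
    also have "\<dots> = M"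
      using pos by (simp add: e_def)
    finally show thesis using e that by blast
  qed
  have "norm (u + t *\<^sub>R x) < M" if t: "0 < t" "t \<le> e" for t
  proof -
    define a where "a = t / e"
    have a: "0 < a" "a \<le> 1" using t e by (simp_all add: a_def)
    have "u + t *\<^sub>R x = (1 - a) *\<^sub>R u + a *\<^sub>R (u + e *\<^sub>R x)"
      using e by (simp add: a_def algebra_simps)
    then have "norm (u + t *\<^sub>R x) \<le> (1 - a) * norm u + a * norm (u + e *\<^sub>R x)"
      using a norm_triangle_ineq[of "(1 - a) *\<^sub>R u" "a *\<^sub>R (u + e *\<^sub>R x)"] by simp
    also have "\<dots> < (1 - a) * M + a * M"
      using a e assms by (intro add_le_less_mono mult_left_mono mult_strict_left_mono) auto
    finally show ?thesis by (simp add: algebra_simps)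
  qed
  with e that show thesis by blast
qed

section \<open>One-sided orthogonality in the infinity sum\<close>

lemma InfSum_add_scaleR:
  "InfSum u v + r *\<^sub>R InfSum x y = InfSum (u + r *\<^sub>R x) (v + r *\<^sub>R y)"
  by (simp add: plus_inf_sum_def scaleR_inf_sum_def)

lemma uminus_InfSum: "- InfSum x y = InfSum (- x) (- y)"
  by (simp add: uminus_inf_sum_def)

text \<open>A coordinate of maximal norm that does not shrink keeps the maximum up. If there is
  none, both coordinates drop below the maximum on initial intervals, hence at the common step
  \<open>min d e\<close>.\<close>

lemma bj_orthogonal_pos_InfSum_iff:
  "bj_orthogonal_pos (InfSum u v) (InfSum x y) \<longleftrightarrow>
    norm v \<le> norm u \<and> bj_orthogonal_pos u x \<or> norm u \<le> norm v \<and> bj_orthogonal_pos v y"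
  (is "?L \<longleftrightarrow> ?R")
proof
  assume ?L
  show ?R
  proof (rule ccontr)
    define M where "M = max (norm u) (norm v)"
    assume "\<not> ?R"
    then have "\<not> (norm u = M \<and> bj_orthogonal_pos u x)" "\<not> (norm v = M \<and> bj_orthogonal_pos v y)"
      by (auto simp: M_def max_def split: if_splits)
    moreover have "norm u \<le> M" "norm v \<le> M" by (simp_all add: M_def)
    ultimately obtain d e where
      d: "0 < d" "\<And>t. 0 < t \<Longrightarrow> t \<le> d \<Longrightarrow> norm (u + t *\<^sub>R x) < M" and
      e: "0 < e" "\<And>t. 0 < t \<Longrightarrow> t \<le> e \<Longrightarrow> norm (v + t *\<^sub>R y) < M"
      by (metis norm_add_scaleR_less_near_0)
    have "norm (InfSum u v + min d e *\<^sub>R InfSum x y) < M"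
      using d e by (simp add: InfSum_add_scaleR)
    moreover have "norm (InfSum u v) \<le> norm (InfSum u v + min d e *\<^sub>R InfSum x y)"
      using \<open>?L\<close> d(1) e(1) unfolding bj_orthogonal_pos_def by (meson less_imp_le min_less_iff_conj)
    ultimately show False by (simp add: M_def del: max_less_iff_conj max.bounded_iff)
  qed
next
  assume ?R
  then show ?L
    by (fastforce simp: bj_orthogonal_pos_def InfSum_add_scaleR le_max_iff_disj)
qed

section \<open>Right-symmetric points of the infinity sum\<close>

lemma bj_orthogonal_InfSum_swap:
  "InfSum u v \<bottom>\<^sub>B InfSum x y \<longleftrightarrow> InfSum v u \<bottom>\<^sub>B InfSum y x"
  by (simp add: bj_orthogonal_def InfSum_add_scaleR max.commute)

lemma right_symmetric_InfSum_swap: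
  assumes "right_symmetric (InfSum x y)"
  shows "right_symmetric (InfSum y x)"
  using assms unfolding right_symmetric_def
  by (metis bj_orthogonal_InfSum_swap inf_sum.exhaust)

text \<open>If \<open>y\<close> were strictly longer, take \<open>u\<close> of norm
  \<open>norm y\<close> that does not shrink towards \<open>x\<close>. Then
  \<open>InfSum u (- y)\<close> is orthogonal to \<open>InfSum x y\<close>: \<open>u\<close> guards
  \<open>r \<ge> 0\<close> and \<open>- y\<close> guards \<open>r \<le> 0\<close>. The reversed
  relation fails, since direction \<open>- y\<close> shrinks \<open>y\<close>, the only coordinate
  of maximal norm.\<close>

lemma right_symmetric_InfSum_norm_le:
  fixes x :: "'a::real_normed_vector" and y :: "'b::real_normed_vector"
  assumes nontrivial: "(UNIV :: 'a set) \<noteq> {0}"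
    and sym: "right_symmetric (InfSum x y)"
  shows "norm y \<le> norm x"
proof (rule ccontr)
  assume less: "\<not> norm y \<le> norm x"
  then have y: "y \<noteq> 0" by auto
  have "\<exists>u. norm u = norm y \<and> bj_orthogonal_pos u x"
  proof (cases "x = 0")
    case True
    \<comment> \<open>With \<open>x = 0\<close> any vector of the right norm will do, but one must
      exist.\<close>
    obtain w :: 'a where "w \<noteq> 0" using nontrivial by auto
    then have "norm ((norm y / norm w) *\<^sub>R w) = norm y" by simp
    moreover have "bj_orthogonal_pos ((norm y / norm w) *\<^sub>R w) x"
      using True by (simp add: bj_orthogonal_pos_def)
    ultimately show ?thesis by blast
  next
    case False
    define c where "c = norm y / norm x"
    have "norm (c *\<^sub>R x) \<le> norm (c *\<^sub>R x + r *\<^sub>R x)" if "0 \<le> r" for r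
      using that False
      by (simp flip: scaleR_add_left) (simp add: c_def mult_right_mono)
    then have "bj_orthogonal_pos (c *\<^sub>R x) x" by (simp add: bj_orthogonal_pos_def)
    moreover have "norm (c *\<^sub>R x) = norm y" using False by (simp add: c_def)
    ultimately show ?thesis by blast
  qed
  then obtain u where u: "norm u = norm y" "bj_orthogonal_pos u x" by blast
  have "norm (- y) \<le> norm (- y + r *\<^sub>R (- y))" if "0 \<le> r" for r
  proof -
    have "- y + r *\<^sub>R (- y) = (1 + r) *\<^sub>R (- y)" by (simp add: algebra_simps)
    then have "norm (- y + r *\<^sub>R (- y)) = (1 + r) * norm y" using that by simp
    with that show ?thesis by (simp add: algebra_simps)
  qed
  then have "bj_orthogonal_pos (- y) (- y)" by (simp add: bj_orthogonal_pos_def)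
  with u have "InfSum u (- y) \<bottom>\<^sub>B InfSum x y"
    by (simp add: bj_orthogonal_iff_pos uminus_InfSum bj_orthogonal_pos_InfSum_iff)
  with sym have "bj_orthogonal_pos (InfSum x y) (InfSum u (- y))"
    by (auto simp: right_symmetric_def bj_orthogonal_iff_pos)
  with less have "bj_orthogonal_pos y (- y)"
    by (simp add: bj_orthogonal_pos_InfSum_iff)
  with not_bj_orthogonal_pos_uminus_scaleR[OF y, of 1] show False by simp
qed

text \<open>Pad \<open>u\<close> with \<open>v = c y\<close> and with \<open>v = - c y\<close>,
  scaled so that \<open>u\<close> stays a coordinate of maximal norm. After reversal,
  \<open>y\<close> shrinks on one side for each choice, so \<open>x\<close> must account for that
  side; the two choices cover both sides.\<close>

lemma right_symmetric_InfSum_fst: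
  assumes sym: "right_symmetric (InfSum x y)" and y: "y \<noteq> 0"
  shows "right_symmetric x"
  unfolding right_symmetric_def
proof (intro allI impI)
  fix u
  assume u: "u \<bottom>\<^sub>B x"
  show "x \<bottom>\<^sub>B u"
  proof (cases "u = 0")
    case True
    then show ?thesis by (simp add: bj_orthogonal_def)
  next
    case False
    define c where "c = norm u / norm y"
    have c: "0 < c" using False y by (simp add: c_def)
    have reversed: "InfSum x y \<bottom>\<^sub>B InfSum u v" if "norm v = norm u" for v
    proof -
      have "InfSum u v \<bottom>\<^sub>B InfSum x y"
        using u that
        by (simp add: bj_orthogonal_iff_pos uminus_InfSum bj_orthogonal_pos_InfSum_iff)
      with sym show ?thesis by (simp add: right_symmetric_def)
    qed
    have no: "\<not> bj_orthogonal_pos y (- (c *\<^sub>R y))"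
      using y c by (rule not_bj_orthogonal_pos_uminus_scaleR)
    have norm: "norm (c *\<^sub>R y) = norm u" "norm (- (c *\<^sub>R y)) = norm u"
      using y by (simp_all add: c_def)
    from reversed[OF norm(1)] reversed[OF norm(2)] no show ?thesis
      by (simp add: bj_orthogonal_iff_pos uminus_InfSum bj_orthogonal_pos_InfSum_iff)
  qed
qed

lemma right_symmetric_InfSum:
  assumes x: "right_symmetric x" and y: "right_symmetric y" and eq: "norm x = norm y"
  shows "right_symmetric (InfSum x y)"
proof -
  \<comment> \<open>Whichever coordinate of \<open>w\<close> witnesses the relation, it can be
    reversed there, and by \<open>eq\<close> that coordinate of \<open>InfSum x y\<close> has
    maximal norm.\<close>
  have pos: "bj_orthogonal_pos (InfSum x y) w" if "bj_orthogonal_pos w (InfSum x y)" for w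
    using that x y eq
    by (cases w) (auto simp: bj_orthogonal_pos_InfSum_iff intro: right_symmetric_bj_orthogonal_pos)
  show ?thesis
    unfolding right_symmetric_def bj_orthogonal_iff_pos
    \<comment> \<open>The side \<open>r \<le> 0\<close> is \<open>pos\<close> applied to
      \<open>- w\<close>.\<close>
    using pos by (metis bj_orthogonal_pos_uminus_iff)
qed

theorem theorem2p5:
  fixes x :: "'a::banach" and y :: "'b::banach"
  assumes "(UNIV :: 'a set) \<noteq> {0}" and "(UNIV :: 'b set) \<noteq> {0}"
    and "InfSum x y \<in> sphere 0 1"
  shows "right_symmetric (InfSum x y) \<longleftrightarrow>
    norm x = 1 \<and> norm y = 1 \<and> right_symmetric x \<and> right_symmetric y"
proof
  assume sym: "right_symmetric (InfSum x y)"
  \<comment> \<open>Exchanging the summands supplies the opposite norm inequality and the right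
    symmetry of \<open>y\<close>.\<close>
  note sym' = right_symmetric_InfSum_swap[OF sym]
  have "norm x = norm y"
    using right_symmetric_InfSum_norm_le[OF assms(1) sym]
      right_symmetric_InfSum_norm_le[OF assms(2) sym'] by simp
  then have norm: "norm x = 1" "norm y = 1"
    using assms(3) by simp_all
  then have "x \<noteq> 0" "y \<noteq> 0" by auto
  with norm sym sym' show "norm x = 1 \<and> norm y = 1 \<and> right_symmetric x \<and> right_symmetric y"
    by (auto intro: right_symmetric_InfSum_fst)
next
  assume "norm x = 1 \<and> norm y = 1 \<and> right_symmetric x \<and> right_symmetric y"
  then show "right_symmetric (InfSum x y)"
    by (simp add: right_symmetric_InfSum)
qed

end
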